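(* Let $a\ge -1$, let $p>1$, and let $F(u)=|u|^{p-1}u$ or $F(u)=|u|^{p}$. Let $f\equiv 0$ and let $g\in C^1(\mathbb{R})$ not vanish identically, with $g(x)\ge 0$ for all $x\in\mathbb{R}$ and $\int_{-1}^{1}g(y)\,dy>0$. For $\varepsilon>0$ let $T_\varepsilon=T_\varepsilon(f,g)$ denote the lifespan of the $C^2$-solution of the initial value problem $$u_{tt}-u_{xx}=\frac{F(u(x,t))}{(1+|x|^2)^{(1+a)/2}},\quad (x,t)\in\mathbb{R}\times[0,\infty),\qquad u(x,0)=\varepsilon f(x),\quad u_t(x,0)=\varepsilon g(x),\quad x\in\mathbb{R}.$$ Then there exist positive constants $\varepsilon_0=\varepsilon_0(g,a,p)$ and $C=C(g,a,p)$ such that $$T_\varepsilon\le\begin{cases} C\varepsilon^{-(p-1)/(1-a)} & \text{if } -1\le a<0,\\ \phi^{-1}\big(C\varepsilon^{-(p-1)}\big) & \text{if } a=0,\\ C\varepsilon^{-(p-1)} & \text{if } a>0,\end{cases}$$ holds for any $\varepsilon$ with $0<\varepsilon\le\varepsilon_0$, where $\phi(s)=s\log(2+s)$ for $s\ge 0$.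
   Context: The unknown $u=u(x,t)$ is a real scalar function. The lifespan is defined, for arbitrarily fixed $(f,g)\in C^2(\mathbb{R})\times C^1(\mathbb{R})$, by $$T_\varepsilon=T_\varepsilon(f,g):=\sup\{T\in(0,\infty): \text{there exists a unique solution } u\in C^2(\mathbb{R}\times[0,T)) \text{ of the initial value problem}\}.$$ The function $\phi:[0,\infty)\to[0,\infty)$ is strictly increasing and onto, and $\phi^{-1}$ is its inverse. *)

theory Defs
  imports "HOL-Analysis.Analysis"
begin

text \<open>A function of \<^term>\<open>x\<close> and \<^term>\<open>t\<close> is curried, space variable first. Time derivatives are taken
  within \<open>[0,\<infinity>)\<close>: one-sided at \<open>t = 0\<close> and two-sided for \<open>t > 0\<close>. Thus, for \<open>t < T\<close>, only
  the values of the function on \<open>\<real> \<times> [0,T)\<close> matter.\<close>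

definition partial_x :: "(real \<Rightarrow> real \<Rightarrow> real) \<Rightarrow> real \<Rightarrow> real \<Rightarrow> real" where
  "partial_x u x t = vector_derivative (\<lambda>y. u y t) (at x)"

definition partial_t :: "(real \<Rightarrow> real \<Rightarrow> real) \<Rightarrow> real \<Rightarrow> real \<Rightarrow> real" where
  "partial_t u x t = vector_derivative (\<lambda>s. u x s) (at t within {0..})"

text \<open>\<open>Ck_strip k T u\<close> says \<open>u \<in> C\<^sup>k(\<real> \<times> [0,T))\<close>: all partial derivatives of order at most
  \<open>k\<close> (mixed ones in every order of differentiation) exist and are jointly continuous.\<close>

primrec Ck_strip :: "nat \<Rightarrow> real \<Rightarrow> (real \<Rightarrow> real \<Rightarrow> real) \<Rightarrow> bool" where
  "Ck_strip 0 T u \<longleftrightarrow> continuous_on (UNIV \<times> {0..<T}) (\<lambda>(x, t). u x t)"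
| "Ck_strip (Suc k) T u \<longleftrightarrow>
     continuous_on (UNIV \<times> {0..<T}) (\<lambda>(x, t). u x t) \<and>
     (\<forall>x. \<forall>t\<in>{0..<T}. (\<lambda>y. u y t) differentiable (at x) \<and>
                        (\<lambda>s. u x s) differentiable (at t within {0..})) \<and>
     Ck_strip k T (partial_x u) \<and> Ck_strip k T (partial_t u)"

definition is_solution ::
  "real \<Rightarrow> (real \<Rightarrow> real) \<Rightarrow> (real \<Rightarrow> real) \<Rightarrow> (real \<Rightarrow> real) \<Rightarrow> real \<Rightarrow> real
    \<Rightarrow> (real \<Rightarrow> real \<Rightarrow> real) \<Rightarrow> bool" where
  "is_solution a F f g \<epsilon> T u \<longleftrightarrow>
     Ck_strip 2 T u \<and>
     (\<forall>x. \<forall>t\<in>{0..<T}.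
        partial_t (partial_t u) x t - partial_x (partial_x u) x t
          = F (u x t) / (1 + \<bar>x\<bar>\<^sup>2) powr ((1 + a) / 2)) \<and>
     (\<forall>x. u x 0 = \<epsilon> * f x) \<and>
     (\<forall>x. partial_t u x 0 = \<epsilon> * g x)"

text \<open>The supremum is taken in the extended reals, so that a global solution has lifespan
  \<open>\<infinity>\<close>. Uniqueness is uniqueness of the restriction to \<open>\<real> \<times> [0,T)\<close>, since the values of a
  HOL function outside the strip are irrelevant.\<close>

definition lifespan ::
  "real \<Rightarrow> (real \<Rightarrow> real) \<Rightarrow> (real \<Rightarrow> real) \<Rightarrow> (real \<Rightarrow> real) \<Rightarrow> real \<Rightarrow> ereal" where
  "lifespan a F f g \<epsilon> = Sup (ereal ` {T. 0 < T \<and>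
     (\<exists>u. is_solution a F f g \<epsilon> T u \<and>
        (\<forall>v. is_solution a F f g \<epsilon> T v \<longrightarrow> (\<forall>x. \<forall>t\<in>{0..<T}. v x t = u x t)))})"

definition phi :: "real \<Rightarrow> real" where
  "phi s = s * ln (2 + s)"

lemma strict_mono_on_phi: "strict_mono_on {0..} phi"
proof (rule strict_mono_onI)
  fix r s :: real
  assume rs: "r \<in> {0..}" "s \<in> {0..}" "r < s"
  have "r * ln (2 + r) \<le> r * ln (2 + s)"
    using rs by (intro mult_left_mono) auto
  also have "\<dots> < s * ln (2 + s)"
    using rs by (intro mult_strict_right_mono) auto
  finally show "phi r < phi s"
    by (simp add: phi_def)
qed

lemma bij_betw_phi: "bij_betw phi {0..} {0..}"
proof -
  have "y \<in> phi ` {0..}" if "0 \<le> y" for y :: real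
  proof -
    have "1 \<le> ln (2 + 2 * y + 1)"
      using that exp_le by (subst ln_ge_iff) auto
    then have "y * 1 \<le> (2 * y + 1) * ln (2 + (2 * y + 1))"
      using that by (intro mult_mono) (auto simp: add.assoc)
    then have "y \<le> phi (2 * y + 1)"
      by (simp add: phi_def)
    moreover have "continuous_on {0..2 * y + 1} phi"
      unfolding phi_def by (intro continuous_intros) auto
    ultimately have "\<exists>s\<ge>0. s \<le> 2 * y + 1 \<and> phi s = y"
      using that by (intro IVT') (auto simp: phi_def)
    then show ?thesis by auto
  qed
  moreover have "0 \<le> phi s" if "0 \<le> s" for s
    using that by (simp add: phi_def)
  ultimately show ?thesis
    using strict_mono_on_imp_inj_on[OF strict_mono_on_phi] by (auto simp: bij_betw_def)
qed

text \<open>The inverse of the bijection \<open>phi : [0,\<infinity>) \<rightarrow> [0,\<infinity>)\<close>; unspecified at negative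
  arguments.\<close>

definition phi_inv :: "real \<Rightarrow> real" where
  "phi_inv = the_inv_into {0..} phi"

end

theory Submission
  imports Defs
begin

text \<open>Let \<open>w(x) = (1 + |x|\<^sup>2) powr (-(1 + a)/2)\<close> be the weight and \<open>W\<close> its odd primitive. The proof shows
  that a solution on \<open>\<real> \<times> [0,T)\<close> forces \<open>T \<le> N r\<close> for every \<open>r \<ge> 1\<close> with
  \<open>(c \<epsilon>)\<^sup>p\<^sup>-\<^sup>1 r W(r) \<ge> 1\<close>, where \<open>c\<close> is half the integral of \<open>g\<close> over \<open>[-1,1]\<close> and \<open>N\<close> depends
  on \<open>p\<close> only (\<open>solution_time_le\<close>). As \<open>a \<ge> -1\<close>, the weight decreases in \<open>|x|\<close>, and \<open>r W(r)\<close> grows at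
  least like \<open>r\<^sup>1\<^sup>-\<^sup>a\<close>, \<open>r log r\<close> or \<open>r\<close> according to the sign of \<open>a\<close>, so a constant
  multiple of the stated bound is an admissible \<open>r\<close> (\<open>ex_blow_up_scale\<close>).

  The bound on \<open>T\<close> comes from a doubling iteration. The solution is nonnegative
  (\<open>nonneg_of_nonneg_data\<close>), so both nonlinearities equal \<open>u\<^sup>p\<close>, and the free part of the solution gives
  \<open>u \<ge> c \<epsilon>\<close> on \<open>|x| \<le> t - 1\<close>. If \<open>u \<ge> A\<close> on \<open>|x| \<le> t - \<tau>\<close>, the source in that region yields
  \<open>u \<ge> 2 A\<^sup>p r W(r)\<close> on \<open>|x| \<le> t - \<tau> - 4 r\<close> (\<open>lower_bound_step\<close>). With scales shrinking
  geometrically from \<open>r\<close>, the bound doubles at every step while the total time spent stays below a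
  multiple of \<open>r\<close>, so \<open>u\<close> cannot stay finite (\<open>blow_up\<close>).

  No integral representation of \<open>u\<close> is used. The equation says that \<open>u\<^sub>t + u\<^sub>x\<close> has the source as its
  derivative along incoming characteristics, and \<open>u\<^sub>t + u\<^sub>x\<close> is the derivative of \<open>u\<close> along outgoing
  ones. Every estimate is a monotonicity argument on these lines.\<close>

section \<open>Differentiation of functions on the strip\<close>

lemma strip_continuous: "Ck_strip k T u \<Longrightarrow> continuous_on (UNIV \<times> {0..<T}) (\<lambda>(x, t). u x t)"
  by (cases k) auto

lemma strip_DERIV_x:
  assumes "Ck_strip (Suc k) T u" "0 \<le> t" "t < T"
  shows "((\<lambda>y. u y t) has_real_derivative partial_x u x t) (at x)"
  using assms
  by (auto simp: partial_x_def has_real_derivative_iff_has_vector_derivative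
      vector_derivative_works[symmetric])

lemma strip_DERIV_t:
  assumes "Ck_strip (Suc k) T u" "0 < t" "t < T"
  shows "((\<lambda>s. u x s) has_real_derivative partial_t u x t) (at t)"
proof -
  have "at t within {0..} = at t"
    using assms by (intro at_within_interior) auto
  then show ?thesis
    using assms
    by (auto simp: partial_t_def has_real_derivative_iff_has_vector_derivative
      vector_derivative_works[symmetric] dest!: spec[of _ x] bspec[of _ _ t])
qed

text \<open>A function with both partial derivatives is jointly differentiable once one of them, here
  \<^term>\<open>partial_t u\<close>, is jointly continuous. Only \<open>t > 0\<close> is treated, because the strip is open
  there; the boundary \<open>t = 0\<close> enters later through continuity alone.\<close>

lemma strip_DERIV_diagonal:
  assumes "Ck_strip (Suc k) T u" "0 < t" "t < T"
  shows "((\<lambda>s. u (\<eta> + \<sigma> * s) s) has_real_derivative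
            (partial_t u (\<eta> + \<sigma> * t) t + \<sigma> * partial_x u (\<eta> + \<sigma> * t) t)) (at t)"
proof -
  let ?x = "\<eta> + \<sigma> * t"
  have "Ck_strip k T (partial_t u)"
    using assms by simp
  then have "continuous_on (UNIV \<times> {0<..<T}) (\<lambda>(x, t). partial_t u x t)"
    by (rule continuous_on_subset[OF strip_continuous]) auto
  then have "continuous_on (UNIV \<times> {0<..<T}) (\<lambda>z. blinfun_scaleR_left (partial_t u (fst z) (snd z)))"
    by (intro bounded_linear.continuous_on[OF bounded_linear_blinfun_scaleR_left])
       (simp add: case_prod_beta)
  then have "continuous (at (?x, t) within UNIV \<times> {0<..<T}) (\<lambda>(x, t). blinfun_scaleR_left (partial_t u x t))"
    using assms(2,3) unfolding continuous_on_eq_continuous_within case_prod_beta by auto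
  moreover have "((\<lambda>y. u y t) has_derivative (*) (partial_x u ?x t)) (at ?x within UNIV)"
    using strip_DERIV_x[OF assms(1), of t ?x] assms(2,3) by (simp add: has_field_derivative_def)
  moreover have "((\<lambda>s. u y s) has_derivative blinfun_apply (blinfun_scaleR_left (partial_t u y s)))
      (at s within {0<..<T})" if "s \<in> {0<..<T}" for y s
    using strip_DERIV_t[OF assms(1), of s y] that
    by (auto simp: has_field_derivative_def mult_commute_abs intro!: has_derivative_at_withinI)
  ultimately have "((\<lambda>(x, t). u x t) has_derivative
        (\<lambda>(tx, ty). partial_x u ?x t * tx + blinfun_scaleR_left (partial_t u ?x t) ty))
       (at (?x, t) within UNIV \<times> {0<..<T})"
    using assms(2,3) by (intro has_derivative_partialsI) auto
  moreover have "open (UNIV \<times> {0<..<T} :: (real \<times> real) set)"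
    by (intro open_Times) auto
  ultimately have "((\<lambda>z. u (fst z) (snd z)) has_derivative
        (\<lambda>z. partial_x u ?x t * fst z + partial_t u ?x t * snd z)) (at (?x, t))"
    using assms at_within_open[of "(?x,t)" "UNIV \<times> {0<..<T}"]
    by (simp add: case_prod_unfold mult.commute)
  moreover have "((\<lambda>s. (\<eta> + \<sigma> * s, s)) has_derivative (\<lambda>s. (\<sigma> * s, s))) (at t)"
    by (auto intro!: derivative_eq_intros)
  ultimately have "((\<lambda>z. u (fst z) (snd z)) \<circ> (\<lambda>s. (\<eta> + \<sigma> * s, s)) has_derivative
     (\<lambda>z. partial_x u ?x t * fst z + partial_t u ?x t * snd z) \<circ> (\<lambda>s. (\<sigma> * s, s))) (at t)"
    by (intro diff_chain_at)
  then have "((\<lambda>s. u (\<eta> + \<sigma> * s) s) has_derivative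
      (\<lambda>s. s * (partial_t u ?x t + \<sigma> * partial_x u ?x t))) (at t)"
    by (simp add: o_def algebra_simps)
  then show ?thesis
    by (simp add: has_field_derivative_def mult_commute_abs)
qed

lemma strip_continuous_diagonal:
  assumes "Ck_strip k T u" "0 \<le> r" "s < T"
  shows "continuous_on {r..s} (\<lambda>\<rho>. u (\<eta> + \<sigma> * \<rho>) \<rho>)"
proof -
  have "continuous_on {r..s} ((\<lambda>(x, t). u x t) \<circ> (\<lambda>\<rho>. (\<eta> + \<sigma> * \<rho>, \<rho>)))"
    using assms
    by (intro continuous_on_compose continuous_intros
          continuous_on_subset[OF strip_continuous[OF assms(1)]]) auto
  then show ?thesis by (simp add: o_def)
qed

lemma continuous_eq_if_equal_nearby:
  fixes f g :: "'a::metric_space \<Rightarrow> real"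
  assumes f: "isCont f z" and g: "isCont g z"
    and near: "\<And>d. d > 0 \<Longrightarrow> \<exists>v w. dist v z < d \<and> dist w z < d \<and> f v = g w"
  shows "f z = g z"
proof (rule ccontr)
  assume "f z \<noteq> g z"
  then have e: "\<bar>f z - g z\<bar> / 2 > 0" by simp
  obtain d1 where d1: "d1 > 0" "\<And>v. dist v z < d1 \<Longrightarrow> \<bar>f v - f z\<bar> < \<bar>f z - g z\<bar> / 2"
    using f e unfolding continuous_at_eps_delta dist_real_def by meson
  obtain d2 where d2: "d2 > 0" "\<And>v. dist v z < d2 \<Longrightarrow> \<bar>g v - g z\<bar> < \<bar>f z - g z\<bar> / 2"
    using g e unfolding continuous_at_eps_delta dist_real_def by meson
  obtain v w where "dist v z < min d1 d2" "dist w z < min d1 d2" "f v = g w"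
    using near[of "min d1 d2"] d1 d2 by auto
  then show False using d1(2)[of v] d2(2)[of w] by (auto simp: abs_if split: if_splits)
qed

text \<open>Schwarz's argument: the second difference of \<open>u\<close> over a square of side \<open>h\<close> at \<open>(x,t)\<close> is, by two
  applications of the mean value theorem in either order, \<open>h\<^sup>2\<close> times a value of each mixed partial
  derivative inside the square. The two derivatives thus agree at points arbitrarily close to
  \<open>(x,t)\<close>, and continuity finishes the proof.\<close>

lemma mixed_partials_commute:
  assumes u: "Ck_strip 2 T u" and t: "0 < t" "t < T"
  shows "partial_t (partial_x u) x t = partial_x (partial_t u) x t"
proof -
  have u2: "Ck_strip (Suc (Suc 0)) T u"
    using u by (simp add: numeral_2_eq_2)
  then have ux: "Ck_strip (Suc 0) T (partial_x u)" and ut: "Ck_strip (Suc 0) T (partial_t u)"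
    by simp_all
  have opn: "open (UNIV \<times> {0<..<T} :: (real \<times> real) set)"
    by (intro open_Times) auto
  have cont: "isCont (\<lambda>z. v (fst z) (snd z)) (x, t)" if "Ck_strip 0 T v" for v
  proof -
    have "continuous_on (UNIV \<times> {0<..<T}) (\<lambda>z. v (fst z) (snd z))"
      using strip_continuous[OF that, unfolded case_prod_beta]
      by (rule continuous_on_subset) auto
    then show ?thesis
      using t opn continuous_on_eq_continuous_at by fastforce
  qed
  have "(\<lambda>z. partial_t (partial_x u) (fst z) (snd z)) (x, t) =
        (\<lambda>z. partial_x (partial_t u) (fst z) (snd z)) (x, t)"
  proof (rule continuous_eq_if_equal_nearby[where z = "(x, t)"
        and f = "\<lambda>z. partial_t (partial_x u) (fst z) (snd z)"
        and g = "\<lambda>z. partial_x (partial_t u) (fst z) (snd z)"])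
    show "isCont (\<lambda>z. partial_t (partial_x u) (fst z) (snd z)) (x, t)"
      and "isCont (\<lambda>z. partial_x (partial_t u) (fst z) (snd z)) (x, t)"
      using ux ut by (auto intro!: cont)
    fix d :: real assume d: "d > 0"
    define h where "h = min (d / 3) ((T - t) / 2)"
    have h: "0 < h" "t + h < T" "h < d / 2"
      using d t by (auto simp: h_def min_def field_simps)
    have near: "dist (y, s) (x, t) < d" if "x < y" "y < x + h" "t < s" "s < t + h" for y s
    proof -
      have "dist (y, s) (x, t) \<le> dist (y, s) (y, t) + dist (y, t) (x, t)"
        by (rule dist_triangle)
      also have "\<dots> < d"
        using that h by (simp add: dist_Pair_Pair dist_real_def)
      finally show ?thesis .
    qed
    have "\<exists>y>x. y < x + h \<and> (u (x + h) (t + h) - u (x + h) t) - (u x (t + h) - u x t)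
             = (x + h - x) * (partial_x u y (t + h) - partial_x u y t)"
      using h t strip_DERIV_x[OF u2]
      by (intro MVT2[where f = "\<lambda>y. u y (t + h) - u y t"]) (auto intro!: DERIV_diff)
    then obtain y where y: "x < y" "y < x + h"
      and 1: "u (x + h) (t + h) - u (x + h) t - (u x (t + h) - u x t)
             = h * (partial_x u y (t + h) - partial_x u y t)" by auto
    have "\<exists>s>t. s < t + h \<and> partial_x u y (t + h) - partial_x u y t
             = (t + h - t) * partial_t (partial_x u) y s"
      using h t strip_DERIV_t[OF ux] by (intro MVT2) auto
    then obtain s where s: "t < s" "s < t + h"
      and 2: "partial_x u y (t + h) - partial_x u y t = h * partial_t (partial_x u) y s" by auto
    have "\<exists>s>t. s < t + h \<and> (u (x + h) (t + h) - u x (t + h)) - (u (x + h) t - u x t)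
             = (t + h - t) * (partial_t u (x + h) s - partial_t u x s)"
      using h t strip_DERIV_t[OF u2]
      by (intro MVT2[where f = "\<lambda>s. u (x + h) s - u x s"]) (auto intro!: DERIV_diff)
    then obtain s' where s': "t < s'" "s' < t + h"
      and 3: "u (x + h) (t + h) - u x (t + h) - (u (x + h) t - u x t)
             = h * (partial_t u (x + h) s' - partial_t u x s')" by auto
    have "\<exists>y>x. y < x + h \<and> partial_t u (x + h) s' - partial_t u x s'
             = (x + h - x) * partial_x (partial_t u) y s'"
      using h t s' strip_DERIV_x[OF ut] by (intro MVT2) auto
    then obtain y' where y': "x < y'" "y' < x + h"
      and 4: "partial_t u (x + h) s' - partial_t u x s' = h * partial_x (partial_t u) y' s'" by auto
    have "h * (h * partial_t (partial_x u) y s) = h * (h * partial_x (partial_t u) y' s')"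
      using 1 2 3 4 by (simp add: algebra_simps)
    then have "partial_t (partial_x u) y s = partial_x (partial_t u) y' s'"
      using h by simp
    then show "\<exists>v w. dist v (x, t) < d \<and> dist w (x, t) < d \<and>
        partial_t (partial_x u) (fst v) (snd v) = partial_x (partial_t u) (fst w) (snd w)"
      using near[OF y s] near[OF y' s'] by (metis fst_conv snd_conv)
  qed
  then show ?thesis by simp
qed

section \<open>Comparison along characteristics\<close>

definition dalembertian :: "(real \<Rightarrow> real \<Rightarrow> real) \<Rightarrow> real \<Rightarrow> real \<Rightarrow> real" where
  "dalembertian u x t = partial_t (partial_t u) x t - partial_x (partial_x u) x t"

text \<open>The wave operator factors as \<open>(\<partial>\<^sub>t - \<partial>\<^sub>x) (\<partial>\<^sub>t + \<partial>\<^sub>x)\<close>. This is the image of \<open>u\<close> under the inner factor,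
  that is, the derivative of \<open>u\<close> along the characteristic \<open>s \<mapsto> (\<eta> + s, s)\<close>.\<close>

definition outgoing :: "(real \<Rightarrow> real \<Rightarrow> real) \<Rightarrow> real \<Rightarrow> real \<Rightarrow> real" where
  "outgoing u x t = partial_t u x t + partial_x u x t"

lemma DERIV_outgoing:
  assumes u: "Ck_strip 2 T u" and t: "0 < t" "t < T"
  shows "((\<lambda>s. outgoing u (\<xi> - s) s) has_real_derivative dalembertian u (\<xi> - t) t) (at t)"
proof -
  have "Ck_strip (Suc 0) T (partial_x u)" "Ck_strip (Suc 0) T (partial_t u)"
    using u by (simp_all add: numeral_2_eq_2)
  note this[THEN strip_DERIV_diagonal, OF t, of \<xi> "- 1"]
  from DERIV_add[OF this(2,1)] show ?thesis
    using mixed_partials_commute[OF u t, of "\<xi> - t"]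
    by (simp add: outgoing_def dalembertian_def)
qed

lemma DERIV_along_outgoing:
  assumes u: "Ck_strip 2 T u" and t: "0 < t" "t < T"
  shows "((\<lambda>s. u (\<eta> + s) s) has_real_derivative outgoing u (\<eta> + t) t) (at t)"
  using strip_DERIV_diagonal[of 1 T u t \<eta> 1] assms
  by (simp add: outgoing_def numeral_2_eq_2)

lemma increment_mono:
  fixes f k :: "real \<Rightarrow> real"
  assumes "r \<le> s" "continuous_on {r..s} f"
    and "\<And>\<rho>. r < \<rho> \<Longrightarrow> \<rho> < s \<Longrightarrow> (f has_real_derivative f' \<rho>) (at \<rho>)"
    and "\<And>\<rho>. (k has_real_derivative k' \<rho>) (at \<rho>)"
    and "\<And>\<rho>. r < \<rho> \<Longrightarrow> \<rho> < s \<Longrightarrow> k' \<rho> \<le> f' \<rho>"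
  shows "k s - k r \<le> f s - f r"
proof -
  have "f r - k r \<le> f s - k s"
  proof (rule DERIV_nonneg_imp_increasing_open[where f = "\<lambda>\<rho>. f \<rho> - k \<rho>", OF \<open>r \<le> s\<close>])
    show "continuous_on {r..s} (\<lambda>\<rho>. f \<rho> - k \<rho>)"
      using assms(2) DERIV_atLeastAtMost_imp_continuous_on[of r s k] assms(4)
      by (intro continuous_on_diff) blast+
    show "\<exists>y. DERIV (\<lambda>\<rho>. f \<rho> - k \<rho>) x :> y \<and> y \<ge> 0" if "r < x" "x < s" for x
      using DERIV_diff[OF assms(3)[OF that] assms(4)] assms(5)[OF that] by force
  qed
  then show ?thesis by simp
qed

text \<open>Lower bounds are transported along characteristics by comparing increments with those of an
  explicit function \<open>k\<close>. Used first on \<^term>\<open>outgoing u\<close> and then on \<open>u\<close>, the next two lemmas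
  replace d'Alembert's formula and its double integral over the backward cone.\<close>

lemma outgoing_increment_ge:
  assumes u: "Ck_strip 2 T u" and rs: "0 \<le> r" "r \<le> s" "s < T"
    and k: "\<And>\<rho>. (k has_real_derivative k' \<rho>) (at \<rho>)"
    and le: "\<And>\<rho>. r < \<rho> \<Longrightarrow> \<rho> < s \<Longrightarrow> k' \<rho> \<le> dalembertian u (\<xi> - \<rho>) \<rho>"
  shows "outgoing u (\<xi> - r) r + (k s - k r) \<le> outgoing u (\<xi> - s) s"
proof -
  have "Ck_strip (Suc 0) T (partial_x u)" "Ck_strip (Suc 0) T (partial_t u)"
    using u by (simp_all add: numeral_2_eq_2)
  note this[THEN strip_continuous_diagonal, of r s \<xi> "-1"]
  from continuous_on_add[OF this(2,1)]
  have "continuous_on {r..s} (\<lambda>\<rho>. outgoing u (\<xi> - \<rho>) \<rho>)"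
    using rs by (simp add: outgoing_def)
  then have "k s - k r \<le> outgoing u (\<xi> - s) s - outgoing u (\<xi> - r) r"
    using DERIV_outgoing[OF u] rs
    by (intro increment_mono[where k' = k' and f' = "\<lambda>\<rho>. dalembertian u (\<xi> - \<rho>) \<rho>"] k le) auto
  then show ?thesis by simp
qed

lemma increment_along_outgoing_ge:
  assumes u: "Ck_strip 2 T u" and rs: "0 \<le> r" "r \<le> s" "s < T"
    and k: "\<And>\<rho>. (k has_real_derivative k' \<rho>) (at \<rho>)"
    and le: "\<And>\<rho>. r < \<rho> \<Longrightarrow> \<rho> < s \<Longrightarrow> k' \<rho> \<le> outgoing u (\<eta> + \<rho>) \<rho>"
  shows "u (\<eta> + r) r + (k s - k r) \<le> u (\<eta> + s) s"
proof -
  have "continuous_on {r..s} (\<lambda>\<rho>. u (\<eta> + \<rho>) \<rho>)"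
    using strip_continuous_diagonal[OF u, of r s \<eta> 1] rs by simp
  then have "k s - k r \<le> u (\<eta> + s) s - u (\<eta> + r) r"
    using DERIV_along_outgoing[OF u] rs
    by (intro increment_mono[where k' = k' and f' = "\<lambda>\<rho>. outgoing u (\<eta> + \<rho>) \<rho>"] k le) auto
  then show ?thesis by simp
qed

lemma outgoing_ge_data:
  assumes u: "Ck_strip 2 T u" and t: "0 \<le> t" "t < T"
    and box: "\<And>x t. 0 \<le> t \<Longrightarrow> t < T \<Longrightarrow> 0 \<le> dalembertian u x t"
  shows "outgoing u (x + t) 0 \<le> outgoing u x t"
  using outgoing_increment_ge[OF u order_refl t, of "\<lambda>_. 0" "\<lambda>_. 0" "x + t"] box t by simp

text \<open>A barrier argument. If \<open>u\<close> touches \<open>- \<delta> exp t\<close> somewhere in the backward cone of \<open>(X,\<tau>)\<close>,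
  take a point \<open>(x0,t0)\<close> of contact with the smallest time. Before \<open>t0\<close> the function lies above
  the barrier, so the source is at least \<open>- \<delta> exp t\<close>, and two integrations along
  characteristics give \<open>u \<ge> - \<delta> (exp t0 - t0 - 1)\<close> at \<open>(x0,t0)\<close>, which is strictly above the
  barrier. The lower bound on the source is asked only where \<open>u > - 1\<close>: keeping \<open>\<delta> exp \<tau> \<le> 1\<close>
  makes this enough, and there a source \<open>|u|\<^sup>p\<^sup>-\<^sup>1 u\<close> with a weight at most 1 is indeed at least \<open>u\<close>.\<close>

lemma nonneg_of_nonneg_data:
  assumes u: "Ck_strip 2 T u"
    and box: "\<And>x t. 0 \<le> t \<Longrightarrow> t < T \<Longrightarrow> - 1 < u x t \<Longrightarrow> min 0 (u x t) \<le> dalembertian u x t"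
    and data: "\<And>x. 0 \<le> u x 0" "\<And>x. 0 \<le> outgoing u x 0"
    and \<tau>: "0 \<le> \<tau>" "\<tau> < T"
  shows "0 \<le> u X \<tau>"
proof -
  define K where "K = {z. 0 \<le> snd z \<and> \<bar>fst z - X\<bar> \<le> \<tau> - snd z}"
  have barrier: "- \<delta> * exp \<tau> < u X \<tau>" if \<delta>: "0 < \<delta>" "\<delta> * exp \<tau> \<le> 1" for \<delta>
  proof (rule ccontr)
    assume neg: "\<not> - \<delta> * exp \<tau> < u X \<tau>"
    define B where "B = {z \<in> K. u (fst z) (snd z) + \<delta> * exp (snd z) \<le> 0}"
    have "closed K"
      unfolding K_def by (intro closed_Collect_conj closed_Collect_le continuous_intros)
    moreover have "K \<subseteq> {X - \<tau>..X + \<tau>} \<times> {0..\<tau>}"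
      by (auto simp: K_def)
    ultimately have "compact K"
      by (metis compact_Icc compact_Times compact_Int_closed inf.absorb2)
    moreover have "closed B"
    proof -
      have "continuous_on K (\<lambda>z. u (fst z) (snd z))"
        using strip_continuous[OF u, unfolded case_prod_beta]
        by (rule continuous_on_subset) (use \<tau> in \<open>auto simp: K_def\<close>)
      then have "closed (K \<inter> (\<lambda>z. u (fst z) (snd z) + \<delta> * exp (snd z)) -` {..0})"
        using \<open>closed K\<close> by (intro continuous_closed_preimage continuous_intros) auto
      then show ?thesis by (simp add: B_def Int_def vimage_def)
    qed
    moreover have "B \<subseteq> K" by (auto simp: B_def)
    ultimately have "compact B"
      by (metis compact_Int_closed inf.absorb2)
    moreover have "(X, \<tau>) \<in> B"
      using neg \<tau> by (auto simp: B_def K_def)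
    ultimately have "\<exists>z\<in>B. \<forall>z'\<in>B. snd z \<le> snd z'"
      by (intro continuous_attains_inf continuous_intros) auto
    then obtain z where z: "z \<in> B" "\<And>z'. z' \<in> B \<Longrightarrow> snd z \<le> snd z'"
      by blast
    \<comment> \<open>A contact point with the smallest time.\<close>
    define x0 t0 where "x0 = fst z" and "t0 = snd z"
    have t0: "0 \<le> t0" "t0 < T" and x0: "\<bar>x0 - X\<bar> \<le> \<tau> - t0" and u0: "u x0 t0 + \<delta> * exp t0 \<le> 0"
      using z(1) \<tau> by (auto simp: B_def K_def x0_def t0_def)
    have box_ge: "- \<delta> * exp t \<le> dalembertian u x t"
      if "0 \<le> t" "t < t0" "\<bar>x - X\<bar> \<le> \<tau> - t" for x t
    proof -
      have 1: "- \<delta> * exp t < u x t"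
      proof -
        have "(x, t) \<notin> B" using z(2)[of "(x, t)"] that by (auto simp: t0_def)
        moreover have "(x, t) \<in> K" using that by (simp add: K_def)
        ultimately have "\<not> u x t + \<delta> * exp t \<le> 0" by (simp add: B_def)
        then show ?thesis by simp
      qed
      have "\<delta> * exp t \<le> \<delta> * exp \<tau>"
        using that x0 \<delta> by simp
      then have "- 1 < u x t"
        using 1 \<delta> by linarith
      then have "min 0 (u x t) \<le> dalembertian u x t"
        using that t0 by (intro box) auto
      moreover have "0 \<le> \<delta> * exp t" using \<delta> by simp
      ultimately show ?thesis using 1 by linarith
    qed
    define \<eta> where "\<eta> = x0 - t0"
    have "- \<delta> * (exp s - 1) \<le> outgoing u (\<eta> + s) s" if s: "0 < s" "s < t0" for s
    proof -
      have "outgoing u (\<eta> + 2 * s - 0) 0 + ((- \<delta> * exp s) - (- \<delta> * exp 0))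
              \<le> outgoing u (\<eta> + 2 * s - s) s"
        using s t0 x0
        by (intro outgoing_increment_ge[OF u, where k' = "\<lambda>\<rho>. - \<delta> * exp \<rho>"] box_ge)
           (auto simp: \<eta>_def intro!: derivative_eq_intros)
      then show ?thesis using data(2)[of "\<eta> + 2 * s"] by (simp add: algebra_simps)
    qed
    then have "u (\<eta> + 0) 0 + (- \<delta> * (exp t0 - t0) - (- \<delta> * (exp 0 - 0))) \<le> u (\<eta> + t0) t0"
      using t0
      by (intro increment_along_outgoing_ge[OF u, where k' = "\<lambda>\<rho>. - \<delta> * (exp \<rho> - 1)"])
         (auto intro!: derivative_eq_intros)
    moreover have "\<delta> * (t0 + 1) > 0"
      using \<delta> t0 by simp
    ultimately show False
      using u0 data(1)[of \<eta>] by (simp add: \<eta>_def algebra_simps)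
  qed
  show ?thesis
  proof (rule ccontr)
    assume neg: "\<not> 0 \<le> u X \<tau>"
    define \<delta> where "\<delta> = min 1 (- u X \<tau>) / exp \<tau>"
    have "\<delta> * exp \<tau> = min 1 (- u X \<tau>)" by (simp add: \<delta>_def)
    then show False
      using barrier[of \<delta>] neg by (auto simp: \<delta>_def)
  qed
qed

lemma solution_ge_data_integral:
  assumes u: "Ck_strip 2 T u"
    and box: "\<And>x t. 0 \<le> t \<Longrightarrow> t < T \<Longrightarrow> 0 \<le> dalembertian u x t"
    and data: "\<And>x. 0 \<le> u x 0"
    and \<Gamma>: "\<And>x. (\<Gamma> has_real_derivative outgoing u x 0) (at x)"
    and t: "0 \<le> t" "t < T"
  shows "(\<Gamma> (x + t) - \<Gamma> (x - t)) / 2 \<le> u x t"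
proof -
  define \<eta> where "\<eta> = x - t"
  have "((\<lambda>\<rho>. \<Gamma> (\<eta> + 2 * \<rho>) / 2) has_real_derivative outgoing u (\<eta> + 2 * s) 0) (at s)" for s
    by (auto intro!: derivative_eq_intros DERIV_chain2[OF \<Gamma>])
  moreover have "outgoing u (\<eta> + 2 * s) 0 \<le> outgoing u (\<eta> + s) s" if "0 < s" "s < t" for s
    using outgoing_ge_data[OF u _ _ box, of s "\<eta> + s"] that t by (simp add: algebra_simps)
  ultimately have "u (\<eta> + 0) 0 + (\<Gamma> (\<eta> + 2 * t) / 2 - \<Gamma> (\<eta> + 2 * 0) / 2) \<le> u (\<eta> + t) t"
    using t by (intro increment_along_outgoing_ge[OF u]) auto
  then show ?thesis
    using data[of \<eta>] by (simp add: \<eta>_def algebra_simps diff_divide_distrib)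
qed

section \<open>Growth of lower bounds for an even decreasing weight\<close>

text \<open>Here \<open>W\<close> is the odd primitive of the weight. It enters in place of integrals of \<open>w\<close>, and all
  that matters about the weight is how fast \<open>r * W r\<close> grows.\<close>

locale decaying_weight =
  fixes w W :: "real \<Rightarrow> real"
  assumes DERIV_W: "\<And>y. (W has_real_derivative w y) (at y)"
    and W_0: "W 0 = 0"
    and even: "\<And>y. w (- y) = w y"
    and nonneg: "\<And>y. 0 \<le> w y"
    and antimono: "\<And>x y. 0 \<le> x \<Longrightarrow> x \<le> y \<Longrightarrow> w y \<le> w x"
begin

lemma W_mono: "x \<le> y \<Longrightarrow> W x \<le> W y"
  using DERIV_nonneg_imp_nondecreasing DERIV_W nonneg by blast

lemma W_minus: "W (- y) = - W y"
proof -
  have "((\<lambda>y. W (- y) + W y) has_real_derivative 0) (at y)" for y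
    by (auto intro!: derivative_eq_intros DERIV_chain2[OF DERIV_W] DERIV_W simp: even)
  then have "W (- y) + W y = W (- 0) + W 0"
    using DERIV_isconst_all[of "\<lambda>y. W (- y) + W y"] by blast
  then show ?thesis by (simp add: W_0)
qed

text \<open>An interval of length \<open>2 r\<close> around the origin has at least length \<open>r\<close> on one side of it.\<close>

lemma W_increment_ge:
  assumes "0 \<le> b" "b \<le> 2 * r" "c \<le> b - 2 * r"
  shows "W r \<le> W b - W c"
proof (cases "r \<le> b")
  case True
  then show ?thesis using W_mono[of r b] W_mono[of c 0] assms W_0 by simp
next
  case False
  then show ?thesis
    using W_mono[of 0 b] W_mono[of c "- r"] assms W_0 W_minus[of r] by simp
qed

text \<open>The primitive is concave on \<open>[0,\<infinity>)\<close>, because the weight decreases there.\<close>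

lemma W_scale:
  assumes "0 \<le> l" "l \<le> 1" "0 \<le> r"
  shows "l * W r \<le> W (l * r)"
proof -
  have "W (l * 0) - l * W 0 \<le> W (l * r) - l * W r"
  proof (rule DERIV_nonneg_imp_nondecreasing[OF \<open>0 \<le> r\<close>])
    fix x :: real assume "0 \<le> x" "x \<le> r"
    then have "l * w x \<le> l * w (l * x)"
      using assms by (intro mult_left_mono antimono mult_left_le_one_le) auto
    moreover have "((\<lambda>r. W (l * r) - l * W r) has_real_derivative l * w (l * x) - l * w x) (at x)"
      by (auto intro!: derivative_eq_intros DERIV_chain2[OF DERIV_W] DERIV_W)
    ultimately show "\<exists>y. ((\<lambda>r. W (l * r) - l * W r) has_real_derivative y) (at x) \<and> 0 \<le> y"
      by force
  qed
  then show ?thesis by (simp add: W_0)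
qed

lemma W_ge:
  assumes "0 \<le> r"
  shows "r * w r \<le> W r"
proof -
  have "W 0 - 0 * w r \<le> W r - r * w r"
  proof (rule DERIV_nonneg_imp_nondecreasing[OF \<open>0 \<le> r\<close>])
    fix x :: real assume "0 \<le> x" "x \<le> r"
    then have "0 \<le> w x - w r" using antimono by simp
    moreover have "((\<lambda>x. W x - x * w r) has_real_derivative w x - w r) (at x)"
      by (auto intro!: derivative_eq_intros DERIV_W)
    ultimately show "\<exists>y. ((\<lambda>x. W x - x * w r) has_real_derivative y) (at x) \<and> 0 \<le> y"
      by blast
  qed
  then show ?thesis by (simp add: W_0)
qed

text \<open>The cone below \<open>(x,t)\<close>, cut off by \<open>|y| \<le> s - \<tau>\<close>, contains the square in characteristic
  coordinates with \<open>\<tau> \<le> s \<plusminus> y \<le> \<tau> + 4 r\<close>, however far from the axis \<open>x\<close> is. This square is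
  centred on the axis, where the weight is largest. On an incoming
  characteristic that crosses it, the outgoing derivative has gained at least \<^term>\<open>A * W r\<close> by the
  upper left side, and the outgoing characteristic through \<open>(x,t)\<close>, which lies on or beyond that
  side, collects this gain over a time \<open>2 r\<close>.\<close>

lemma lower_bound_step:
  assumes u: "Ck_strip 2 T u"
    and box: "\<And>x t. 0 \<le> t \<Longrightarrow> t < T \<Longrightarrow> 0 \<le> dalembertian u x t"
    and data: "\<And>x. 0 \<le> u x 0" "\<And>x. 0 \<le> outgoing u x 0"
    and source: "\<And>x t. \<bar>x\<bar> \<le> t - \<tau> \<Longrightarrow> t < T \<Longrightarrow> A * w x \<le> dalembertian u x t"
    and pos: "0 \<le> A" "0 \<le> \<tau>" "0 \<le> r"
    and xt: "\<bar>x\<bar> \<le> t - (\<tau> + 4 * r)" "t < T"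
  shows "2 * A * r * W r \<le> u x t"
proof -
  \<comment> \<open>\<open>s1\<close> and \<open>s2\<close> are the times at which the outgoing characteristic meets the incoming ones
    through the bottom corner and the right corner of the square.\<close>
  define \<eta> s1 s2 where "\<eta> = x - t" and "s1 = (\<tau> - \<eta>) / 2" and "s2 = s1 + 2 * r"
  have order: "0 \<le> s1" "s1 \<le> s2" "s2 \<le> t"
    using xt pos by (auto simp: s1_def s2_def \<eta>_def field_simps)
  have out_nonneg: "0 \<le> outgoing u y s" if "0 \<le> s" "s < T" for y s
    using outgoing_ge_data[OF u that box] data(2)[of "y + s"] by (simp add: order_trans)
  have out_ge: "A * W r \<le> outgoing u (\<eta> + s) s" if s: "s1 \<le> s" "s \<le> s2" for s
  proof -
    \<comment> \<open>The incoming characteristic \<open>x + t = q\<close> enters the region \<open>|y| \<le> \<rho> - \<tau>\<close> at time \<open>\<rho>0\<close>.\<close>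
    define q \<rho>0 where "q = \<eta> + 2 * s" and "\<rho>0 = (q + \<tau>) / 2"
    have q: "\<tau> \<le> q" "q \<le> \<tau> + 4 * r"
      using s by (auto simp: q_def s1_def s2_def field_simps)
    have \<eta>: "\<eta> \<le> - (\<tau> + 4 * r)"
      using xt by (auto simp: \<eta>_def)
    have "outgoing u (q - \<rho>0) \<rho>0 + (- A * W (q - s) - (- A * W (q - \<rho>0)))
            \<le> outgoing u (q - s) s"
    proof (rule outgoing_increment_ge[OF u, where k' = "\<lambda>\<rho>. A * w (q - \<rho>)"])
      show "0 \<le> \<rho>0" "\<rho>0 \<le> s" "s < T"
        using q \<eta> pos order s xt by (auto simp: \<rho>0_def q_def)
      show "((\<lambda>\<rho>. - A * W (q - \<rho>)) has_real_derivative A * w (q - \<rho>)) (at \<rho>)" for \<rho>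
        by (auto intro!: derivative_eq_intros DERIV_chain2[OF DERIV_W])
      show "A * w (q - \<rho>) \<le> dalembertian u (q - \<rho>) \<rho>" if "\<rho>0 < \<rho>" "\<rho> < s" for \<rho>
        using that q order s xt by (intro source) (auto simp: \<rho>0_def)
    qed
    moreover have "0 \<le> outgoing u (q - \<rho>0) \<rho>0"
      using q \<eta> pos order s xt by (intro out_nonneg) (auto simp: \<rho>0_def q_def)
    moreover have "A * W r \<le> A * (W (q - \<rho>0) - W (q - s))"
      using q \<eta> pos by (intro mult_left_mono W_increment_ge) (auto simp: \<rho>0_def q_def field_simps)
    moreover have "q - s = \<eta> + s" by (simp add: q_def)
    ultimately show ?thesis by (simp add: algebra_simps)
  qed
  have "0 \<le> u (\<eta> + s1) s1"
    using increment_along_outgoing_ge[OF u, of 0 s1 "\<lambda>_. 0" "\<lambda>_. 0" \<eta>]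
      out_nonneg order xt data(1)[of \<eta>] by auto
  also have "\<dots> + (A * W r * s2 - A * W r * s1) \<le> u (\<eta> + s2) s2"
    using order xt out_ge
    by (intro increment_along_outgoing_ge[OF u, where k' = "\<lambda>_. A * W r"])
       (auto intro!: derivative_eq_intros)
  also have "u (\<eta> + s2) s2 \<le> u (\<eta> + t) t"
    using increment_along_outgoing_ge[OF u, of s2 t "\<lambda>_. 0" "\<lambda>_. 0" \<eta>]
      out_nonneg order xt by auto
  finally show ?thesis
    by (simp add: s2_def \<eta>_def algebra_simps)
qed

text \<open>Iterating the step, the lower bound doubles each time: from \<open>2\<^sup>k A\<close> with scale \<open>r q\<^sup>k\<close> one gets
  \<open>(2\<^sup>k A)\<^sup>p 2 (r q\<^sup>k) W (r q\<^sup>k) \<ge> 2\<^sup>k\<^sup>+\<^sup>1 A \<cdot> A\<^sup>p\<^sup>-\<^sup>1 r W(r)\<close>, using concavity of \<open>W\<close> and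
  \<open>2\<^sup>p q\<^sup>2 = 2\<close>. Since \<open>q < 1\<close>, infinitely many steps fit before the time \<open>1 + 4 r / (1 - q)\<close>, and
  no real value of \<open>u\<close> on the axis at that time can exceed all \<open>2\<^sup>k A\<close>.\<close>

lemma blow_up:
  assumes u: "Ck_strip 2 T u"
    and u_nonneg: "\<And>x t. 0 \<le> t \<Longrightarrow> t < T \<Longrightarrow> 0 \<le> u x t"
    and wave: "\<And>x t. 0 \<le> t \<Longrightarrow> t < T \<Longrightarrow> dalembertian u x t = u x t powr p * w x"
    and data: "\<And>x. 0 \<le> outgoing u x 0"
    and lower: "\<And>x t. \<bar>x\<bar> \<le> t - 1 \<Longrightarrow> t < T \<Longrightarrow> A \<le> u x t"
    and p: "1 < p" and A: "0 < A" and r: "0 < r"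
    and large: "1 \<le> A powr (p - 1) * (r * W r)"
  shows "T \<le> 1 + 4 * r / (1 - 2 powr (- (p - 1) / 2))"
proof (cases "0 < T")
  case True
  define q :: real where "q = 2 powr (- (p - 1) / 2)"
  have q: "0 < q" "q < 1"
    using p by (auto simp: q_def powr_less_one)
  \<comment> \<open>This balance of the growth of the bound against the loss of scale determines \<open>q\<close>.\<close>
  have q2: "2 powr p * (q * q) = 2"
  proof -
    have "2 powr p * (q * q) = (2::real) powr (p + (- (p - 1) / 2) + (- (p - 1) / 2))"
      by (simp only: q_def powr_add mult.assoc)
    also have "\<dots> = 2" by simp
    finally show ?thesis .
  qed
  have box: "0 \<le> dalembertian u x t" if "0 \<le> t" "t < T" for x t
    using wave[OF that] nonneg[of x] by simp
  have iter: "2 ^ k * A \<le> u x t"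
    if "\<bar>x\<bar> \<le> t - (1 + 4 * r * (\<Sum>j<k. q ^ j))" "t < T" for k x t
    using that
  proof (induction k arbitrary: x t)
    case 0
    then show ?case using lower by simp
  next
    case (Suc k)
    define \<tau> where "\<tau> = 1 + 4 * r * (\<Sum>j<k. q ^ j)"
    have \<tau>: "1 \<le> \<tau>"
      using r q by (auto simp: \<tau>_def intro!: mult_nonneg_nonneg sum_nonneg)
    have source: "(2 ^ k * A) powr p * w x \<le> dalembertian u x t" if "\<bar>x\<bar> \<le> t - \<tau>" "t < T" for x t
    proof -
      have "(2 ^ k * A) powr p \<le> u x t powr p"
        using Suc.IH[of x t] that A p by (intro powr_mono2) (auto simp: \<tau>_def)
      moreover have "0 \<le> t" using that \<tau> by linarith
      ultimately show ?thesis
        using wave[of t x] that nonneg[of x] by (simp add: mult_right_mono)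
    qed
    have "2 * (2 ^ k * A) powr p * (q ^ k * r) * W (q ^ k * r) \<le> u x t"
    proof (rule lower_bound_step[OF u box _ data source])
      show "\<bar>x\<bar> \<le> t - (\<tau> + 4 * (q ^ k * r))"
        using Suc.prems by (simp add: \<tau>_def algebra_simps)
    qed (use Suc.prems \<tau> q r u_nonneg[of 0] True in auto)
    moreover have "2 ^ Suc k * A \<le> 2 * (2 ^ k * A) powr p * (q ^ k * r) * W (q ^ k * r)"
    proof -
      have "2 ^ Suc k * A * 1 \<le> 2 ^ Suc k * A * (A powr (p - 1) * (r * W r))"
        using large A by (intro mult_left_mono) auto
      also have "\<dots> = 2 * 2 ^ k * (A * A powr (p - 1)) * (r * W r)"
        by simp
      also have "A * A powr (p - 1) = A powr p"
        using powr_add[of A 1 "p - 1"] A by simp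
      also have "(2::real) ^ k = (2 ^ k) powr p * (q ^ k * q ^ k)"
      proof -
        have "((2::real) ^ k) powr p = (2 powr p) ^ k"
          by (simp add: powr_powr powr_realpow[symmetric] mult.commute)
        then show ?thesis
          using q2 by (simp add: power_mult_distrib[symmetric])
      qed
      also have "2 * ((2 ^ k) powr p * (q ^ k * q ^ k)) * A powr p * (r * W r)
          = 2 * (2 ^ k * A) powr p * (q ^ k * r) * (q ^ k * W r)"
        using A by (simp add: powr_mult algebra_simps)
      also have "\<dots> \<le> 2 * (2 ^ k * A) powr p * (q ^ k * r) * W (q ^ k * r)"
        using q r W_scale[of "q ^ k" r] by (intro mult_left_mono) (auto simp: power_le_one)
      finally show ?thesis by simp
    qed
    ultimately show ?case by linarith
  qed
  show ?thesis
  proof (rule ccontr)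
    assume "\<not> ?thesis"
    then have T: "1 + 4 * r / (1 - q) < T" by (simp add: q_def)
    define t where "t = 1 + 4 * r / (1 - q)"
    have bound: "2 ^ k * A \<le> u 0 t" for k
    proof (rule iter)
      have "(\<Sum>j<k. q ^ j) = (1 - q ^ k) / (1 - q)"
        using q sum_gp_strict[of q k] by simp
      also have "\<dots> \<le> 1 / (1 - q)"
        using q by (intro divide_right_mono) auto
      finally have "4 * r * (\<Sum>j<k. q ^ j) \<le> 4 * r * (1 / (1 - q))"
        using r by (intro mult_left_mono) auto
      then show "\<bar>0\<bar> \<le> t - (1 + 4 * r * (\<Sum>j<k. q ^ j))"
        by (simp add: t_def)
    qed (use T t_def in simp)
    obtain k where "u 0 t / A < 2 ^ k"
      using real_arch_pow[of 2 "u 0 t / A"] by auto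
    then show False
      using bound[of k] A by (simp add: field_simps)
  qed
next
  case False
  have "2 powr (- (p - 1) / 2) < (1::real)"
    using p by (simp add: powr_less_one)
  then have "0 \<le> 4 * r / (1 - 2 powr (- (p - 1) / 2))"
    using r by simp
  then show ?thesis using False by linarith
qed

end

section \<open>The weight and the solution\<close>

definition weight :: "real \<Rightarrow> real \<Rightarrow> real" where
  "weight a x = (1 + \<bar>x\<bar>\<^sup>2) powr (- ((1 + a) / 2))"

lemma antiderivative_ex:
  fixes f :: "real \<Rightarrow> real"
  assumes "continuous_on UNIV f"
  shows "\<exists>F. F 0 = 0 \<and> (\<forall>y. (F has_real_derivative f y) (at y))"
proof -
  obtain F where F: "\<And>y. (F has_real_derivative f y) (at y)"
    using einterval_antiderivative[of "-\<infinity>" "\<infinity>" f] assms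
    by (auto simp: has_real_derivative_iff_has_vector_derivative continuous_on_eq_continuous_at)
  then show ?thesis
    by (intro exI[of _ "\<lambda>y. F y - F 0"]) (auto intro!: derivative_eq_intros)
qed

text \<open>A primitive is chosen by description because no elementary formula covers all \<open>a\<close>.\<close>

definition weight_primitive :: "real \<Rightarrow> real \<Rightarrow> real" where
  "weight_primitive a = (SOME W. W 0 = 0 \<and> (\<forall>y. (W has_real_derivative weight a y) (at y)))"

lemma weight_pos: "0 < weight a y"
proof -
  have "0 < 1 + \<bar>y\<bar>\<^sup>2"
    by (intro add_pos_nonneg) auto
  then show ?thesis by (simp add: weight_def)
qed

lemma decaying_weight_primitive:
  assumes "a \<ge> - 1"
  shows "decaying_weight (weight a) (weight_primitive a)"
proof -
  have nz: "1 + \<bar>y\<bar>\<^sup>2 > 0" for y :: real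
    by (intro add_pos_nonneg) auto
  have "continuous_on UNIV (weight a)"
    unfolding weight_def using nz by (intro continuous_intros ballI) (metis less_irrefl)
  then have "weight_primitive a 0 = 0 \<and> (\<forall>y. (weight_primitive a has_real_derivative weight a y) (at y))"
    unfolding weight_primitive_def by (rule someI_ex[OF antiderivative_ex])
  moreover have "weight a y \<le> weight a x" if "0 \<le> x" "x \<le> y" for x y
    unfolding weight_def using that assms nz[of x]
    by (intro powr_mono2') (auto intro!: power_mono)
  ultimately show ?thesis
    using weight_pos by unfold_locales (auto simp: weight_def less_imp_le)
qed

text \<open>Both nonlinearities equal \<open>u\<^sup>p\<close> for \<open>u \<ge> 0\<close>, so nothing distinguishes them once the solution
  is known to be nonnegative.\<close>

lemma solution_properties:
  assumes a: "a \<ge> - 1" and p: "p > 1"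
    and F: "F \<in> {(\<lambda>u. \<bar>u\<bar> powr (p - 1) * u), (\<lambda>u. \<bar>u\<bar> powr p)}"
    and g: "\<And>x. 0 \<le> g x" and \<epsilon>: "0 < \<epsilon>"
    and sol: "is_solution a F (\<lambda>x. 0) g \<epsilon> T u"
  shows "\<And>x. outgoing u x 0 = \<epsilon> * g x"
    and "\<And>x t. 0 \<le> t \<Longrightarrow> t < T \<Longrightarrow> 0 \<le> u x t"
    and "\<And>x t. 0 \<le> t \<Longrightarrow> t < T \<Longrightarrow> dalembertian u x t = u x t powr p * weight a x"
proof -
  have u: "Ck_strip 2 T u" and u0: "\<And>x. u x 0 = 0" and ut0: "\<And>x. partial_t u x 0 = \<epsilon> * g x"
    and wave: "\<And>x t. 0 \<le> t \<Longrightarrow> t < T \<Longrightarrow> dalembertian u x t = F (u x t) * weight a x"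
    using sol by (auto simp: is_solution_def dalembertian_def weight_def powr_minus_divide)
  interpret decaying_weight "weight a" "weight_primitive a"
    using a by (rule decaying_weight_primitive)
  have weight_le: "weight a x \<le> 1" for x
  proof -
    have "weight a \<bar>x\<bar> \<le> weight a 0" by (rule antimono) auto
    then show ?thesis by (simp add: weight_def)
  qed
  have out: "outgoing u x 0 = \<epsilon> * g x" for x
    using u0 ut0 by (simp add: outgoing_def partial_x_def)
  then show "outgoing u x 0 = \<epsilon> * g x" for x .
  have F_nonneg: "F v = v powr p" if "0 \<le> v" for v
    using F that powr_add[of v "p - 1" 1] by auto
  have F_neg: "v \<le> F v" if "- 1 < v" "v < 0" for v
  proof -
    have "\<bar>v\<bar> powr (p - 1) * \<bar>v\<bar> \<le> 1 * \<bar>v\<bar>"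
      using that p by (intro mult_right_mono powr_le1) auto
    moreover have "0 \<le> \<bar>v\<bar> powr p" by simp
    ultimately show ?thesis using F that by (auto intro: order_trans[of v 0])
  qed
  have box: "min 0 (u x t) \<le> dalembertian u x t" if "0 \<le> t" "t < T" "- 1 < u x t" for x t
  proof (cases "0 \<le> u x t")
    case True
    then show ?thesis
      using that wave F_nonneg nonneg[of x] by simp
  next
    case False
    then have "u x t * 1 \<le> u x t * weight a x"
      using weight_le by (intro mult_left_mono_neg) auto
    also have "\<dots> \<le> F (u x t) * weight a x"
      using False that nonneg F_neg by (intro mult_right_mono) auto
    finally show ?thesis using that wave by simp
  qed
  show u_nonneg: "0 \<le> u x t" if "0 \<le> t" "t < T" for x t
  proof (rule nonneg_of_nonneg_data[OF u box _ _ that])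
    show "0 \<le> outgoing u x 0" for x using out g \<epsilon> by simp
  qed (simp_all add: u0)
  show "dalembertian u x t = u x t powr p * weight a x" if "0 \<le> t" "t < T" for x t
    using wave[OF that] F_nonneg u_nonneg[OF that] by simp
qed

text \<open>On \<open>|x| \<le> t - 1\<close> the interval of dependence of \<open>(x,t)\<close> contains \<open>[-1,1]\<close>, which gives the
  initial lower bound of order \<open>\<epsilon>\<close>. The additive 1 in the blow-up time is absorbed by \<open>r \<ge> 1\<close>.\<close>

lemma solution_time_le:
  assumes a: "a \<ge> - 1" and p: "p > 1"
    and g: "continuous_on UNIV g" "\<And>x. 0 \<le> g x" "0 < integral {-1..1} g"
    and F: "F \<in> {(\<lambda>u. \<bar>u\<bar> powr (p - 1) * u), (\<lambda>u. \<bar>u\<bar> powr p)}"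
    and \<epsilon>: "0 < \<epsilon>" and r: "1 \<le> r"
    and large: "1 \<le> (integral {-1..1} g / 2 * \<epsilon>) powr (p - 1) * (r * weight_primitive a r)"
    and sol: "is_solution a F (\<lambda>x. 0) g \<epsilon> T u" and T: "0 < T"
  shows "T \<le> (1 + 4 / (1 - 2 powr (- (p - 1) / 2))) * r"
proof -
  interpret decaying_weight "weight a" "weight_primitive a"
    using a by (rule decaying_weight_primitive)
  note sol_props = solution_properties[OF a p F g(2) \<epsilon> sol]
  have u: "Ck_strip 2 T u"
    using sol by (simp add: is_solution_def)
  obtain \<Gamma> where \<Gamma>: "\<And>y. (\<Gamma> has_real_derivative g y) (at y)"
    using antiderivative_ex[OF g(1)] by blast
  have \<Gamma>_mono: "\<Gamma> x \<le> \<Gamma> y" if "x \<le> y" for x y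
    using DERIV_nonneg_imp_nondecreasing[OF that] \<Gamma> g(2) by blast
  have integral_g: "integral {-1..1} g = \<Gamma> 1 - \<Gamma> (-1)"
    using \<Gamma>
    by (intro integral_unique fundamental_theorem_of_calculus)
       (auto simp: has_real_derivative_iff_has_vector_derivative[symmetric] has_field_derivative_at_within)
  have "T \<le> 1 + 4 * r / (1 - 2 powr (- (p - 1) / 2))"
  proof (rule blow_up[OF u sol_props(2,3)])
    show "0 \<le> outgoing u x 0" for x
      using sol_props(1) g(2) \<epsilon> by simp
    show "integral {-1..1} g / 2 * \<epsilon> \<le> u x t" if xt: "\<bar>x\<bar> \<le> t - 1" "t < T" for x t
    proof -
      have "((\<lambda>x. \<epsilon> * \<Gamma> x) has_real_derivative outgoing u x 0) (at x)" for x
        using sol_props(1) by (auto intro!: derivative_eq_intros \<Gamma>)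
      moreover have "0 \<le> dalembertian u x t" if "0 \<le> t" "t < T" for x t
        using sol_props(3)[OF that] nonneg[of x] by simp
      ultimately have "(\<epsilon> * \<Gamma> (x + t) - \<epsilon> * \<Gamma> (x - t)) / 2 \<le> u x t"
        using xt sol_props(2) T by (intro solution_ge_data_integral[OF u]) auto
      moreover have "\<epsilon> * (\<Gamma> 1 - \<Gamma> (-1)) \<le> \<epsilon> * (\<Gamma> (x + t) - \<Gamma> (x - t))"
        using xt \<epsilon> by (intro mult_left_mono diff_mono \<Gamma>_mono) auto
      ultimately show ?thesis
        by (simp add: integral_g algebra_simps)
    qed
  qed (use p g \<epsilon> r large in auto)
  also have "\<dots> \<le> (1 + 4 / (1 - 2 powr (- (p - 1) / 2))) * r"
    using r by (simp add: algebra_simps)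
  finally show ?thesis .
qed

section \<open>The blow-up scale\<close>

lemma weight_one: "weight a 1 = 2 powr (- ((1 + a) / 2))"
  by (simp add: weight_def)

lemma weight_one_le_primitive:
  assumes "a \<ge> - 1" "1 \<le> r"
  shows "weight a 1 \<le> weight_primitive a r"
proof -
  interpret decaying_weight "weight a" "weight_primitive a"
    using assms(1) by (rule decaying_weight_primitive)
  show ?thesis using W_ge[of 1] W_mono[OF assms(2)] by simp
qed

lemma weight_primitive_ge_powr:
  assumes "a \<ge> - 1" "1 \<le> r"
  shows "weight a 1 * r powr (- a) \<le> weight_primitive a r"
proof -
  interpret decaying_weight "weight a" "weight_primitive a"
    using assms(1) by (rule decaying_weight_primitive)
  have "1 + r\<^sup>2 \<le> 2 * r\<^sup>2"
    using assms(2) one_le_power[of r 2] by simp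
  then have "(2 * r\<^sup>2) powr (- ((1 + a) / 2)) \<le> (1 + r\<^sup>2) powr (- ((1 + a) / 2))"
    using assms by (intro powr_mono2') (auto intro: add_pos_nonneg)
  also have "(2 * r\<^sup>2) powr (- ((1 + a) / 2)) = weight a 1 * r powr (- a - 1)"
  proof -
    have "2 * (- ((1 + a) / 2)) = - a - 1"
      by (simp add: field_simps)
    then have "(r powr 2) powr (- ((1 + a) / 2)) = r powr (- a - 1)"
      by (simp only: powr_powr)
    moreover have "r\<^sup>2 = r powr 2" using assms by simp
    ultimately show ?thesis
      using assms by (simp add: weight_one powr_mult del: powr_numeral)
  qed
  finally have "r * (weight a 1 * r powr (- a - 1)) \<le> r * weight a r"
    using assms by (intro mult_left_mono) (auto simp: weight_def)
  also have "r * (weight a 1 * r powr (- a - 1)) = weight a 1 * (r powr (- a - 1) * r powr 1)"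
    using assms by simp
  also have "\<dots> = weight a 1 * r powr (- a)"
    by (simp only: powr_add[symmetric]) simp
  also have "r * weight a r \<le> weight_primitive a r"
    using assms W_ge by simp
  finally show ?thesis .
qed

lemma weight_primitive_0_ge_ln:
  assumes "0 \<le> r"
  shows "ln (1 + r) \<le> weight_primitive 0 r"
proof -
  interpret decaying_weight "weight 0" "weight_primitive 0"
    by (rule decaying_weight_primitive) simp
  have "weight_primitive 0 0 - ln (1 + 0) \<le> weight_primitive 0 r - ln (1 + r)"
  proof (rule DERIV_nonneg_imp_nondecreasing[OF assms])
    fix x :: real assume x: "0 \<le> x" "x \<le> r"
    have "sqrt (1 + x\<^sup>2) \<le> 1 + x"
      using x by (intro real_le_lsqrt) (auto simp: power2_eq_square algebra_simps)
    moreover have "0 < sqrt (1 + x\<^sup>2)"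
      by (auto intro: add_pos_nonneg)
    ultimately have "1 / (1 + x) \<le> weight 0 x"
      by (simp add: weight_def powr_minus_divide powr_half_sqrt frac_le)
    moreover have "((\<lambda>x. weight_primitive 0 x - ln (1 + x)) has_real_derivative weight 0 x - 1 / (1 + x)) (at x)"
      using x by (auto intro!: derivative_eq_intros DERIV_W)
    ultimately show "\<exists>y. ((\<lambda>x. weight_primitive 0 x - ln (1 + x)) has_real_derivative y) (at x) \<and> 0 \<le> y"
      by force
  qed
  then show ?thesis using W_0 by simp
qed

lemma phi_inv_props:
  assumes "0 \<le> y"
  shows "0 \<le> phi_inv y" "phi (phi_inv y) = y"
  using assms bij_betw_phi the_inv_into_into[of phi "{0..}" y "{0..}"]
    f_the_inv_into_f_bij_betw[OF bij_betw_phi, of y]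
  by (auto simp: phi_inv_def bij_betw_def)

lemma le_phi_inv_iff:
  assumes "0 \<le> s" "0 \<le> y"
  shows "s \<le> phi_inv y \<longleftrightarrow> phi s \<le> y"
  using strict_mono_on_leD[OF strict_mono_on_phi, of s "phi_inv y"]
    strict_mono_onD[OF strict_mono_on_phi, of "phi_inv y" s] phi_inv_props[OF assms(2)] assms
  by (force simp: not_le)

text \<open>For \<open>s \<ge> 1\<close> the logarithm \<open>ln (2 + s)\<close> is at least 1 and absorbs \<open>ln N \<le> N - 1\<close>.\<close>

lemma phi_scale_le:
  assumes N: "1 \<le> N" and s: "1 \<le> s"
  shows "phi (N * s) \<le> N\<^sup>2 * phi s"
proof -
  have "exp 1 \<le> 2 + s"
    using exp_le s by linarith
  then have ln_ge: "1 \<le> ln (2 + s)"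
    using s by (subst ln_ge_iff) auto
  have "ln (2 + N * s) \<le> ln (N * (2 + s))"
    using N s by (intro ln_mono) (auto simp: algebra_simps intro: add_pos_nonneg)
  also have "\<dots> = ln N + ln (2 + s)"
    using N s by (intro ln_mult_pos) auto
  also have "\<dots> \<le> (N - 1) * ln (2 + s) + ln (2 + s)"
    using N ln_ge ln_le_minus_one[of N] mult_left_mono[OF ln_ge, of "N - 1"] by simp
  finally have "N * s * ln (2 + N * s) \<le> N * s * (N * ln (2 + s))"
    using N s by (intro mult_left_mono) (auto simp: algebra_simps)
  then show ?thesis by (simp add: phi_def power2_eq_square algebra_simps)
qed

lemma phi_le_2_weight_primitive_0:
  assumes "1 \<le> r"
  shows "phi r \<le> 2 * (r * weight_primitive 0 r)"
proof -
  have "2 + r \<le> (1 + r)\<^sup>2"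
    using assms mult_mono[of 1 r 1 r] by (simp add: power2_eq_square algebra_simps)
  then have "ln (2 + r) \<le> ln ((1 + r)\<^sup>2)"
    using assms by (intro ln_mono) auto
  also have "\<dots> = 2 * ln (1 + r)"
    using assms by (simp add: ln_realpow)
  also have "\<dots> \<le> 2 * weight_primitive 0 r"
    using weight_primitive_0_ge_ln[of r] assms by simp
  finally show ?thesis
    using assms by (simp add: phi_def mult_left_mono)
qed

text \<open>Solving \<open>r W(r) \<approx> \<epsilon>\<^sup>-\<^sup>(\<^sup>p\<^sup>-\<^sup>1\<^sup>)\<close> for \<open>r\<close> gives the three regimes of the lifespan, since \<open>r W(r)\<close> grows
  like \<open>r\<^sup>1\<^sup>-\<^sup>a\<close> for \<open>a < 0\<close>, like \<open>r log r\<close> for \<open>a = 0\<close>, and like \<open>r\<close> for \<open>a > 0\<close>. The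
  restriction \<open>\<epsilon> \<le> 1\<close> makes \<open>r \<ge> 1\<close>, where these growth bounds hold.\<close>

lemma ex_blow_up_scale:
  assumes a: "a \<ge> - 1" and p: "p > 1" and B: "1 \<le> B" and N: "1 \<le> N"
  shows "\<exists>C>0. \<forall>\<epsilon>. 0 < \<epsilon> \<and> \<epsilon> \<le> 1 \<longrightarrow>
      (\<exists>r\<ge>1. B * \<epsilon> powr (- (p - 1)) \<le> r * weight_primitive a r \<and>
        N * r \<le> (if a < 0 then C * \<epsilon> powr (- (p - 1) / (1 - a))
         else if a = 0 then phi_inv (C * \<epsilon> powr (- (p - 1)))
         else C * \<epsilon> powr (- (p - 1))))"
proof -
  define bound where "bound C \<epsilon> = (if a < 0 then C * \<epsilon> powr (- (p - 1) / (1 - a))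
         else if a = 0 then phi_inv (C * \<epsilon> powr (- (p - 1)))
         else C * \<epsilon> powr (- (p - 1)))" for C \<epsilon>
  \<comment> \<open>The power-type growth bounds for \<open>W\<close> carry the factor \<open>m \<le> 1\<close>; dividing it out keeps the constant at
    least 1, so that raising it to the power \<open>1 - a \<ge> 1\<close> does not decrease it.\<close>
  define m D where "m = weight a 1" and "D = B / m"
  have m: "0 < m" "m \<le> 1"
    using weight_pos powr_mono[of "- ((1 + a) / 2)" 0 "2 :: real"] a
    by (auto simp: m_def weight_one)
  have D: "1 \<le> D" "m * D = B"
    using B m by (auto simp: D_def)
  have eps_powr: "1 \<le> \<epsilon> powr (- e)" if "0 < \<epsilon>" "\<epsilon> \<le> 1" "0 \<le> e" for \<epsilon> e :: real
    using powr_mono2'[of "- e" \<epsilon> 1] that by simp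
  have "\<exists>C>0. \<forall>\<epsilon>. 0 < \<epsilon> \<and> \<epsilon> \<le> 1 \<longrightarrow>
      (\<exists>r\<ge>1. B * \<epsilon> powr (- (p - 1)) \<le> r * weight_primitive a r \<and> N * r \<le> bound C \<epsilon>)"
  proof -
    consider "a < 0" | "a = 0" | "a > 0" by linarith
    then show ?thesis
    proof cases
      case 1
      have "\<exists>r\<ge>1. B * \<epsilon> powr (- (p - 1)) \<le> r * weight_primitive a r \<and> N * r \<le> bound (N * D) \<epsilon>"
        if \<epsilon>: "0 < \<epsilon>" "\<epsilon> \<le> 1" for \<epsilon>
      proof -
        define r where "r = D * \<epsilon> powr (- (p - 1) / (1 - a))"
        have "1 \<le> \<epsilon> powr (- ((p - 1) / (1 - a)))"
          using \<epsilon> p 1 by (intro eps_powr) auto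
        then have r: "1 \<le> r"
          using D mult_mono[of 1 D 1 "\<epsilon> powr (- (p - 1) / (1 - a))"]
          by (simp add: r_def minus_divide_left)
        have "D * \<epsilon> powr (- (p - 1)) \<le> D powr (1 - a) * \<epsilon> powr (- (p - 1))"
          using powr_mono[of 1 "1 - a" D] D 1 by (intro mult_right_mono) auto
        also have "\<dots> = r powr (1 - a)"
          using D 1 by (simp add: r_def powr_mult powr_powr)
        also have "\<dots> = r * r powr (- a)"
          using r powr_add[of r 1 "- a"] by simp
        finally have "m * (D * \<epsilon> powr (- (p - 1))) \<le> m * (r * r powr (- a))"
          using m by (intro mult_left_mono) auto
        also have "\<dots> = r * (m * r powr (- a))"
          by simp
        also have "\<dots> \<le> r * weight_primitive a r"
          using r weight_primitive_ge_powr[OF a r] by (simp add: m_def)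
        finally have "B * \<epsilon> powr (- (p - 1)) \<le> r * weight_primitive a r"
          by (simp only: D(2)[symmetric] mult.assoc)
        moreover have "N * r = bound (N * D) \<epsilon>"
          using 1 by (simp add: r_def bound_def)
        ultimately show ?thesis using r by auto
      qed
      then show ?thesis using N D by (intro exI[of _ "N * D"]) auto
    next
      case 2
      have "\<exists>r\<ge>1. B * \<epsilon> powr (- (p - 1)) \<le> r * weight_primitive a r \<and> N * r \<le> bound (N\<^sup>2 * (2 * B)) \<epsilon>"
        if \<epsilon>: "0 < \<epsilon>" "\<epsilon> \<le> 1" for \<epsilon>
      proof -
        \<comment> \<open>The factor 2 is the loss in \<open>\<phi>(r) \<le> 2 r W(r)\<close>, and \<open>N\<^sup>2\<close> is the price of moving \<open>N\<close> inside \<open>\<phi>\<^sup>-\<^sup>1\<close>.\<close>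
        define y where "y = 2 * B * \<epsilon> powr (- (p - 1))"
        have y: "2 \<le> y"
          using B eps_powr[OF \<epsilon>, of "p - 1"] p mult_mono[of 1 B 1 "\<epsilon> powr (- (p - 1))"]
          by (simp add: y_def)
        have "phi 1 \<le> y"
          using y ln_le_minus_one[of 3] by (simp add: phi_def)
        then have r: "1 \<le> phi_inv y"
          using y by (simp add: le_phi_inv_iff)
        have phi_y: "phi (phi_inv y) = y"
          using y by (intro phi_inv_props) simp
        have "B * \<epsilon> powr (- (p - 1)) \<le> phi_inv y * weight_primitive a (phi_inv y)"
          using phi_le_2_weight_primitive_0[OF r] phi_y 2 by (simp add: y_def)
        moreover have "N * phi_inv y \<le> phi_inv (N\<^sup>2 * y)"
          using phi_scale_le[OF N r] r y N phi_y by (subst le_phi_inv_iff) auto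
        moreover have "phi_inv (N\<^sup>2 * y) = bound (N\<^sup>2 * (2 * B)) \<epsilon>"
          using 2 by (simp add: y_def bound_def mult.assoc)
        ultimately show ?thesis using r by auto
      qed
      then show ?thesis using N B by (intro exI[of _ "N\<^sup>2 * (2 * B)"]) auto
    next
      case 3
      have "\<exists>r\<ge>1. B * \<epsilon> powr (- (p - 1)) \<le> r * weight_primitive a r \<and> N * r \<le> bound (N * D) \<epsilon>"
        if \<epsilon>: "0 < \<epsilon>" "\<epsilon> \<le> 1" for \<epsilon>
      proof -
        define r where "r = D * \<epsilon> powr (- (p - 1))"
        have r: "1 \<le> r"
          using D eps_powr[OF \<epsilon>, of "p - 1"] p mult_mono[of 1 D 1 "\<epsilon> powr (- (p - 1))"]
          by (simp add: r_def)
        have "B * \<epsilon> powr (- (p - 1)) = r * m"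
          by (simp add: r_def D(2)[symmetric])
        also have "\<dots> \<le> r * weight_primitive a r"
          using r weight_one_le_primitive[OF a r] by (simp add: m_def)
        finally have "B * \<epsilon> powr (- (p - 1)) \<le> r * weight_primitive a r" .
        moreover have "N * r = bound (N * D) \<epsilon>"
          using 3 by (simp add: r_def bound_def)
        ultimately show ?thesis using r by auto
      qed
      then show ?thesis using N D by (intro exI[of _ "N * D"]) auto
    qed
  qed
  then show ?thesis by (simp only: bound_def)
qed

section \<open>The lifespan\<close>

theorem theorem1p1:
  fixes a p :: real and g :: "real \<Rightarrow> real"
  assumes "a \<ge> -1" and "p > 1"
    and "g C1_differentiable_on UNIV"
    and "\<exists>x. g x \<noteq> 0"
    and "\<forall>x. g x \<ge> 0"
    and "integral {-1..1} g > 0"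
  shows "\<exists>\<epsilon>\<^sub>0>0. \<exists>C>0.
    \<forall>F \<in> {(\<lambda>u. \<bar>u\<bar> powr (p - 1) * u), (\<lambda>u. \<bar>u\<bar> powr p)}.
    \<forall>\<epsilon>. 0 < \<epsilon> \<and> \<epsilon> \<le> \<epsilon>\<^sub>0 \<longrightarrow>
      lifespan a F (\<lambda>x. 0) g \<epsilon> \<le> ereal
        (if a < 0 then C * \<epsilon> powr (- (p - 1) / (1 - a))
         else if a = 0 then phi_inv (C * \<epsilon> powr (- (p - 1)))
         else C * \<epsilon> powr (- (p - 1)))"
proof -
  \<comment> \<open>The maximum with 1 in \<open>B\<close> makes the scale \<open>r\<close> at least 1 for all \<open>\<epsilon> \<le> 1\<close>.\<close>
  define c where "c = integral {-1..1} g / 2"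
  define B where "B = max 1 (c powr (- (p - 1)))"
  define N where "N = 1 + 4 / (1 - 2 powr (- (p - 1) / 2) :: real)"
  have c: "0 < c" and B: "1 \<le> B" "c powr (- (p - 1)) \<le> B"
    using assms(6) by (auto simp: c_def B_def)
  have N: "1 \<le> N"
  proof -
    have "2 powr (- (p - 1) / 2) < (1::real)"
      using assms(2) by (simp add: powr_less_one)
    then show ?thesis by (simp add: N_def)
  qed
  have cont: "continuous_on UNIV g"
    using assms(3) by (rule C1_differentiable_imp_continuous_on)
  have lifespan_le: "lifespan a F (\<lambda>x. 0) g \<epsilon> \<le> ereal M"
    if F: "F \<in> {(\<lambda>u. \<bar>u\<bar> powr (p - 1) * u), (\<lambda>u. \<bar>u\<bar> powr p)}" and \<epsilon>: "0 < \<epsilon>"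
      and r: "1 \<le> r" "B * \<epsilon> powr (- (p - 1)) \<le> r * weight_primitive a r" and M: "N * r \<le> M"
    for F \<epsilon> r M
  proof -
    have "1 = (c * \<epsilon>) powr (p - 1) * (c * \<epsilon>) powr (- (p - 1))"
      using c \<epsilon> by (simp add: powr_add[symmetric])
    also have "\<dots> = (c * \<epsilon>) powr (p - 1) * (c powr (- (p - 1)) * \<epsilon> powr (- (p - 1)))"
      using c \<epsilon> by (simp add: powr_mult)
    also have "\<dots> \<le> (c * \<epsilon>) powr (p - 1) * (B * \<epsilon> powr (- (p - 1)))"
      using B by (intro mult_left_mono mult_right_mono) auto
    also have "\<dots> \<le> (c * \<epsilon>) powr (p - 1) * (r * weight_primitive a r)"
      using r(2) by (intro mult_left_mono) auto
    finally have large: "1 \<le> (c * \<epsilon>) powr (p - 1) * (r * weight_primitive a r)" .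
    have "T \<le> M" if "0 < T" "is_solution a F (\<lambda>x. 0) g \<epsilon> T u" for T u
      using solution_time_le[OF assms(1,2) cont _ assms(6) F \<epsilon> r(1) _ that(2,1)] large assms(5) M
      by (force simp: c_def N_def)
    then show ?thesis
      unfolding lifespan_def by (intro Sup_least) auto
  qed
  obtain C where "C > 0"
    and C: "\<And>\<epsilon>. 0 < \<epsilon> \<Longrightarrow> \<epsilon> \<le> 1 \<Longrightarrow>
      \<exists>r\<ge>1. B * \<epsilon> powr (- (p - 1)) \<le> r * weight_primitive a r \<and>
        N * r \<le> (if a < 0 then C * \<epsilon> powr (- (p - 1) / (1 - a))
         else if a = 0 then phi_inv (C * \<epsilon> powr (- (p - 1)))
         else C * \<epsilon> powr (- (p - 1)))"
    using ex_blow_up_scale[OF assms(1,2) B(1) N] by blast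
  have "lifespan a F (\<lambda>x. 0) g \<epsilon> \<le> ereal
        (if a < 0 then C * \<epsilon> powr (- (p - 1) / (1 - a))
         else if a = 0 then phi_inv (C * \<epsilon> powr (- (p - 1)))
         else C * \<epsilon> powr (- (p - 1)))"
    if "F \<in> {(\<lambda>u. \<bar>u\<bar> powr (p - 1) * u), (\<lambda>u. \<bar>u\<bar> powr p)}" "0 < \<epsilon>" "\<epsilon> \<le> 1" for F \<epsilon>
    using C[OF that(2,3)] lifespan_le[OF that(1,2)] by blast
  then show ?thesis
    using \<open>C > 0\<close> by (meson zero_less_one)
qed

end
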